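(* Let $p$ be an odd prime, let $\mathbb{P}=\mathbb{C}_p[x]$, and let $r\ge1$ be an integer. For every polynomial $q(x)\in\mathbb{P}$, $$\underbrace{\int_{\mathbb{Z}_p}\cdots\int_{\mathbb{Z}_p}}_{r\text{ times}}q(x_1+\cdots+x_r+x)\,d\mu_{-1}(x_1)\cdots d\mu_{-1}(x_r)=\left(\frac{2}{e^t+1}\right)^r q(x).$$ In particular, for every integer $n\ge0$, $$E_n^{(r)}(x)=\left(\frac{2}{e^t+1}\right)^r x^n=\left(\int_{\mathbb{Z}_p}\cdots\int_{\mathbb{Z}_p}e^{(x_1+\cdots+x_r)t}\,d\mu_{-1}(x_1)\cdots d\mu_{-1}(x_r)\right)x^n .$$ That is, $E_n^{(r)}(x)$ is the Appell sequence $$E_n^{(r)}(x)\sim\left(\frac{1}{\int_{\mathbb{Z}_p}\cdots\int_{\mathbb{Z}_p}e^{(x_1+\cdots+x_r)t}\,d\mu_{-1}(x_1)\cdots d\mu_{-1}(x_r)},\ t\right).$$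
   Context: $p$ is a fixed odd prime; $\mathbb{Z}_p$ is the ring of $p$-adic integers and $\mathbb{C}_p$ is the completion of the algebraic closure of $\mathbb{Q}_p$. Fermionic $p$-adic integral: for a continuous function $f:\mathbb{Z}_p\to\mathbb{C}_p$, $$\int_{\mathbb{Z}_p}f(x)\,d\mu_{-1}(x)=\lim_{N\to\infty}\sum_{x=0}^{p^N-1}f(x)(-1)^x .$$ Multiple integrals are iterated integrals over $x_1,\dots,x_r\in\mathbb{Z}_p$; those involving the free variable $x$ are regarded as functions (polynomials) of $x$, $x\in\mathbb{C}_p$. $\mathcal{F}$ is the algebra of formal power series $f(t)=\sum_{k\ge0}\frac{a_k}{k!}t^k$ with $a_k\in\mathbb{C}_p$. Each $f(t)\in\mathcal{F}$ defines a linear functional on $\mathbb{P}=\mathbb{C}_p[x]$, written $\langle f(t)\,|\,q(x)\rangle$, determined by linearity and $\langle f(t)\,|\,x^n\rangle=a_n$. It also acts on $\mathbb{P}$ as a differential operator by $t^kq(x)=\frac{d^kq(x)}{dx^k}$, i.e. $f(t)q(x)=\sum_{k\ge0}\frac{a_k}{k!}q^{(k)}(x)$ (a finite sum). The symbol $\int_{\mathbb{Z}_p}\cdots\int_{\mathbb{Z}_p}e^{(x_1+\cdots+x_r)t}\,d\mu_{-1}(x_1)\cdots d\mu_{-1}(x_r)$ ($r$ integrals) denotes the formal power series $\sum_{k\ge0}\left(\int_{\mathbb{Z}_p}\cdots\int_{\mathbb{Z}_p}(x_1+\cdots+x_r)^k\,d\mu_{-1}(x_1)\cdots d\mu_{-1}(x_r)\right)\frac{t^k}{k!}\in\mathcal{F}$.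 Quotients such as $\frac{2}{e^t+1}$, with $e^t=\sum_{k\ge0}t^k/k!$, are taken in the ring of formal power series. The Euler polynomials of order $r$ are defined by $\left(\frac{2}{e^t+1}\right)^re^{xt}=\sum_{n\ge0}E_n^{(r)}(x)\frac{t^n}{n!}$. Sheffer and Appell sequences: let $f(t),g(t)\in\mathcal{F}$, where $f(t)$ has order $1$ (zero constant term, nonzero coefficient of $t$) and $g(t)$ has nonzero constant term (is invertible). The Sheffer sequence for $(g(t),f(t))$, written $s_n(x)\sim(g(t),f(t))$, is the unique sequence of polynomials $s_n(x)\in\mathbb{P}$ with $\deg s_n=n$ such that $\langle g(t)f(t)^k\,|\,s_n(x)\rangle=n!\,\delta_{n,k}$ for all $n,k\ge0$. When $f(t)=t$ it is called the Appell sequence for $g(t)$. *)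

theory Defs
  imports
    "HOL-Analysis.Analysis"
    "HOL-Computational_Algebra.Computational_Algebra"
begin

text \<open>
  Fields of characteristic 0 with a real-valued absolute value, topologised by the metric
  \<open>dist x y = absval (x - y)\<close>.  The library classes such as \<open>real_normed_field\<close> do not apply,
  because they include a real vector space structure compatible with the norm.
\<close>

class valued_field = field_char_0 + metric_space +
  fixes absval :: "'a \<Rightarrow> real"
  assumes dist_absval: "dist x y = absval (x - y)"
    and absval_mult: "absval (x * y) = absval x * absval y"

text \<open>The field of \<open>p\<close>-adic complex numbers\<close>

definition padic_val :: "nat \<Rightarrow> rat \<Rightarrow> int" where
  "padic_val p a =
     int (multiplicity (int p) (fst (quotient_of a))) - int (multiplicity (int p) (snd (quotient_of a)))"

definition padic_abs :: "nat \<Rightarrow> rat \<Rightarrow> real" where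
  "padic_abs p a = (if a = 0 then 0 else real p powi (- padic_val p a))"

text \<open>
  In a complete valued field whose absolute value restricts to the \<open>p\<close>-adic one on the rationals,
  the closure of the rationals is the completion of the rationals, i.e. the field of \<open>p\<close>-adic
  numbers, and its unit ball is the ring of \<open>p\<close>-adic integers.
\<close>

definition padic_numbers :: "'a::valued_field set" where
  "padic_numbers = closure \<rat>"

definition algebraic_elements :: "'a::field set \<Rightarrow> 'a set" where
  "algebraic_elements K = {z. \<exists>f. f \<noteq> 0 \<and> (\<forall>i. coeff f i \<in> K) \<and> poly f z = 0}"

definition algebraically_closed :: "'a::field set \<Rightarrow> bool" where
  "algebraically_closed L \<longleftrightarrow>
     (\<forall>f. (\<forall>i. coeff f i \<in> L) \<and> degree f > 0 \<longrightarrow> (\<exists>z\<in>L. poly f z = 0))"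

text \<open>
  The type \<open>'a\<close>, with its absolute value, is the completion of an algebraic closure of the field of
  \<open>p\<close>-adic numbers.  This determines \<open>'a\<close> up to isometric isomorphism.
\<close>

definition is_padic_complex :: "nat \<Rightarrow> 'a::valued_field itself \<Rightarrow> bool" where
  "is_padic_complex p T \<longleftrightarrow>
     (\<forall>a. absval (of_rat a :: 'a) = padic_abs p a) \<and>
     algebraically_closed (algebraic_elements (padic_numbers :: 'a set)) \<and>
     closure (algebraic_elements (padic_numbers :: 'a set)) = UNIV \<and>
     complete (UNIV :: 'a set)"

text \<open>The fermionic integral\<close>

text \<open>
  A function on the \<open>p\<close>-adic integers is represented by a function on the whole field; since the
  sums evaluate it at natural numbers only, its values outside the \<open>p\<close>-adic integers are irrelevant.
\<close>

definition fermionic_integral :: "nat \<Rightarrow> ('a::valued_field \<Rightarrow> 'a) \<Rightarrow> 'a" where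
  "fermionic_integral p f = lim (\<lambda>N. \<Sum>x = 0..p ^ N - 1. f (of_nat x) * (- 1) ^ x)"

text \<open>
  The iterated integral of \<open>F [x\<^sub>1, \<dots>, x\<^sub>r]\<close>: the integral over \<open>x\<^sub>1\<close> is the innermost one, the
  integral over \<open>x\<^sub>r\<close> the outermost.
\<close>

primrec fermionic_iterated :: "nat \<Rightarrow> nat \<Rightarrow> ('a::valued_field list \<Rightarrow> 'a) \<Rightarrow> 'a" where
  "fermionic_iterated p 0 F = F []"
| "fermionic_iterated p (Suc r) F =
     fermionic_integral p (\<lambda>y. fermionic_iterated p r (\<lambda>xs. F (xs @ [y])))"

text \<open>
  The series written as the \<open>r\<close>-fold integral of \<open>exp ((x\<^sub>1 + \<dots> + x\<^sub>r) t)\<close>, defined by termwise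
  integration.
\<close>

definition fermionic_exp :: "nat \<Rightarrow> nat \<Rightarrow> 'a::valued_field fps" where
  "fermionic_exp p r =
     Abs_fps (\<lambda>k. fermionic_iterated p r (\<lambda>xs. sum_list xs ^ k) / fact k)"

text \<open>
  Umbral calculus.  A series \<open>f = (\<Sum>k. a\<^sub>k / k! t\<^sup>k)\<close> is represented by its ordinary
  coefficients, so \<open>a\<^sub>k = fact k * f $ k\<close>.
\<close>

definition umbral_pairing :: "'a::field_char_0 fps \<Rightarrow> 'a poly \<Rightarrow> 'a" where
  "umbral_pairing f q = (\<Sum>n\<le>degree q. coeff q n * (fact n * fps_nth f n))"

text \<open>All derivatives of \<open>q\<close> of order greater than \<open>degree q\<close> vanish.\<close>

definition umbral_op :: "'a::field_char_0 fps \<Rightarrow> 'a poly \<Rightarrow> 'a poly" where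
  "umbral_op f q = (\<Sum>k\<le>degree q. smult (fps_nth f k) ((pderiv ^^ k) q))"

definition sheffer :: "(nat \<Rightarrow> 'a::field_char_0 poly) \<Rightarrow> 'a fps \<Rightarrow> 'a fps \<Rightarrow> bool" where
  "sheffer s g f \<longleftrightarrow>
     fps_nth g 0 \<noteq> 0 \<and> fps_nth f 0 = 0 \<and> fps_nth f 1 \<noteq> 0 \<and>
     (\<forall>n. degree (s n) = n) \<and>
     (\<forall>n k. umbral_pairing (g * f ^ k) (s n) = (if n = k then fact n else 0))"

definition appell :: "(nat \<Rightarrow> 'a::field_char_0 poly) \<Rightarrow> 'a fps \<Rightarrow> bool" where
  "appell s g \<longleftrightarrow> sheffer s g fps_X"

text \<open>Euler polynomials of higher order\<close>

definition euler_series :: "'a::field_char_0 fps" where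
  "euler_series = 2 / (fps_exp 1 + 1)"

text \<open>
  The generating function is a power series in \<open>t\<close> with coefficients in the polynomial ring;
  scalar series are embedded coefficientwise, and \<open>exp (x t)\<close> has the coefficients \<open>x\<^sup>k / k!\<close>.
\<close>

definition euler_poly :: "nat \<Rightarrow> nat \<Rightarrow> 'a::field_char_0 poly" where
  "euler_poly r n =
     smult (fact n)
       (fps_nth (Abs_fps (\<lambda>k. [:fps_nth (euler_series ^ r) k:]) * Abs_fps (\<lambda>k. monom (1 / fact k) k)) n)"

lemma poly_euler_poly:
  "Abs_fps (\<lambda>n. poly (euler_poly r n) x / fact n) = euler_series ^ r * fps_exp (x::'a::field_char_0)"
  by (rule fps_ext)
     (simp add: euler_poly_def fps_mult_nth poly_sum poly_monom mult.commute)

lemma umbral_pairing_monom: "umbral_pairing f (monom 1 n) = fact n * fps_nth f n"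
proof -
  have "umbral_pairing f (monom 1 n) = (\<Sum>k\<le>n. if k = n then fact n * fps_nth f n else 0)"
    unfolding umbral_pairing_def by (rule sum.cong) (auto simp: degree_monom_eq)
  then show ?thesis by simp
qed

end

theory Submission
  imports Defs
begin

text \<open>
  With \<open>E = 2 / (e\<^sup>t + 1)\<close> and \<open>G\<^sub>r = E\<^sup>r q\<close>, the identity \<open>(e\<^sup>t + 1) E = 2\<close> says
  \<open>G\<^sub>r\<^sub>+\<^sub>1(x + 1) + G\<^sub>r\<^sub>+\<^sub>1(x) = 2 G\<^sub>r(x)\<close>.  Since \<open>p\<^sup>N\<close> is odd, the alternating sum of \<open>G\<^sub>r(x + y)\<close> over
  \<open>0 \<le> y < p\<^sup>N\<close> telescopes to \<open>(G\<^sub>r\<^sub>+\<^sub>1(x) + G\<^sub>r\<^sub>+\<^sub>1(x + p\<^sup>N)) / 2\<close>, which tends to \<open>G\<^sub>r\<^sub>+\<^sub>1(x)\<close> because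
  polynomials are continuous and \<open>p\<^sup>N \<rightarrow> 0\<close>.  Each integration therefore contributes one factor \<open>E\<close>.
\<close>

section \<open>Umbral operators\<close>

text \<open>Derivatives beyond the degree vanish, so the sum may run to any larger bound. A bound
  shared by several polynomials is what makes linearity a termwise computation.\<close>

lemma umbral_op_cutoff:
  assumes "degree q \<le> N"
  shows "umbral_op f q = (\<Sum>k\<le>N. smult (fps_nth f k) ((pderiv ^^ k) q))"
proof -
  have "(pderiv ^^ k) q = 0" if "k > degree q" for k
    by (rule poly_eqI) (use that in \<open>simp add: coeff_higher_pderiv coeff_eq_0\<close>)
  then show ?thesis
    unfolding umbral_op_def by (intro sum.mono_neutral_left) (use assms in auto)
qed

lemma umbral_op_add: "umbral_op f (q + s) = umbral_op f q + umbral_op f s"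
proof -
  define N where "N = max (degree q) (degree s)"
  have "degree (q + s) \<le> N" "degree q \<le> N" "degree s \<le> N"
    by (auto simp: N_def degree_add_le_max)
  then show ?thesis
    by (simp add: umbral_op_cutoff[where N = N] higher_pderiv_add smult_add_right sum.distrib)
qed

lemma umbral_op_smult: "umbral_op f (smult c q) = smult c (umbral_op f q)"
  using degree_smult_le[of c q]
  by (simp add: umbral_op_cutoff[where N = "degree q"] higher_pderiv_smult poly_eq_iff coeff_sum
      sum_distrib_left mult_ac)

lemma umbral_op_0 [simp]: "umbral_op f 0 = 0"
  by (simp add: umbral_op_def)

lemma umbral_op_sum: "umbral_op f (sum g A) = (\<Sum>i\<in>A. umbral_op f (g i))"
  by (induction A rule: infinite_finite_induct) (auto simp: umbral_op_add)

lemma coeff_umbral_op_monom: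
  fixes f :: "'a::field_char_0 fps"
  shows "coeff (umbral_op f (monom 1 n)) i =
    (if i \<le> n then fact n / fact i * fps_nth f (n - i) else 0)"
proof -
  \<comment> \<open>\<open>coeff_higher_pderiv\<close> yields a Pochhammer symbol; as a quotient of
    factorials it becomes \<open>fact n / fact i\<close> for the only contributing order
    \<open>k = n - i\<close>.\<close>
  have poch: "pochhammer (of_nat (Suc i)) k = (fact (i + k) / fact i :: 'a)" for k
  proof -
    have "fact (i + k) = (fact i * pochhammer (of_nat (Suc i)) k :: 'a)"
      using pochhammer_product'[of "1::'a" i k] by (simp add: pochhammer_fact)
    then show ?thesis by simp
  qed
  have "coeff (umbral_op f (monom 1 n)) i =
      (\<Sum>k\<le>n. if n = i + k then fact n / fact i * fps_nth f k else 0)"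
    by (subst umbral_op_cutoff[where N = n])
       (auto simp: degree_monom_le coeff_sum coeff_higher_pderiv poch simp del: of_nat_Suc
         intro!: sum.cong)
  also have "\<dots> = (\<Sum>k\<le>n. if k = n - i then (if i \<le> n then fact n / fact i * fps_nth f k else 0) else 0)"
    by (rule sum.cong) auto
  finally show ?thesis
    by simp
qed

lemma degree_umbral_op_monom_le: "degree (umbral_op f (monom 1 n)) \<le> n"
  by (rule degree_le) (simp add: coeff_umbral_op_monom)

lemma umbral_pairing_cutoff:
  assumes "degree q \<le> N"
  shows "umbral_pairing f q = (\<Sum>n\<le>N. coeff q n * (fact n * fps_nth f n))"
  unfolding umbral_pairing_def
  by (intro sum.mono_neutral_left) (use assms in \<open>auto simp: coeff_eq_0\<close>)

text \<open>Adjointness: letting \<open>f\<close> act on the polynomial amounts to multiplying the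
  functional by \<open>f\<close>, since the pairing unfolds to a Cauchy product.\<close>

lemma umbral_pairing_umbral_op_monom:
  "umbral_pairing h (umbral_op f (monom 1 n)) = fact n * fps_nth (h * f) n"
proof -
  have "umbral_pairing h (umbral_op f (monom 1 n))
      = (\<Sum>i\<le>n. fact n * (fps_nth h i * fps_nth f (n - i)))"
    by (simp add: umbral_pairing_cutoff[OF degree_umbral_op_monom_le] coeff_umbral_op_monom
        mult_ac)
  then show ?thesis
    by (simp add: fps_mult_nth atLeast0AtMost sum_distrib_left)
qed

text \<open>Evaluation at \<open>x\<close> is the functional given by \<open>fps_exp x\<close>.
  Through this, identities between operators reduce to identities between series.\<close>

lemma poly_umbral_op_monom:
  "poly (umbral_op f (monom 1 n)) x = fact n * fps_nth (f * fps_exp x) n"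
proof -
  have "poly (umbral_op f (monom 1 n)) x = (\<Sum>i\<le>n. fact n / fact i * fps_nth f (n - i) * x ^ i)"
    unfolding poly_altdef
    by (intro sum.mono_neutral_cong_left)
       (use degree_umbral_op_monom_le[of f n] in \<open>auto simp: coeff_umbral_op_monom coeff_eq_0 intro!: le_degree\<close>)
  also have "\<dots> = fact n * fps_nth (fps_exp x * f) n"
    unfolding fps_mult_nth sum_distrib_left atLeast0AtMost by (rule sum.cong) simp_all
  finally show ?thesis
    by (simp add: mult.commute)
qed

lemma poly_umbral_op: "poly (umbral_op f q) x = umbral_pairing (f * fps_exp x) q"
proof -
  have "umbral_op f q = umbral_op f (\<Sum>n\<le>degree q. smult (coeff q n) (monom 1 n))"
    by (simp add: smult_monom poly_as_sum_of_monoms)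
  then show ?thesis
    by (simp add: umbral_op_sum umbral_op_smult poly_sum poly_umbral_op_monom umbral_pairing_def)
qed

lemma umbral_op_1: "umbral_op 1 q = q"
  unfolding umbral_op_def by (simp add: if_distrib[of "\<lambda>c. smult c _"] cong: if_cong)

section \<open>The series of Euler numbers\<close>

lemma euler_series_mult: "euler_series * (fps_exp 1 + 1) = (2 :: 'a::field_char_0 fps)"
  by (simp add: euler_series_def fps_divide_unit mult.assoc inverse_mult_eq_1)

lemma euler_series_nth_0 [simp]: "fps_nth (euler_series :: 'a::field_char_0 fps) 0 = 1"
proof -
  have "fps_nth (euler_series * (fps_exp 1 + 1) :: 'a fps) 0 = 2"
    by (simp add: euler_series_mult)
  then show ?thesis by simp
qed

lemma euler_op_shift_add:
  fixes q :: "'a::field_char_0 poly"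
  shows "poly (umbral_op (euler_series ^ Suc r) q) (x + 1) + poly (umbral_op (euler_series ^ Suc r) q) x
    = 2 * poly (umbral_op (euler_series ^ r) q) x"
proof -
  \<comment> \<open>The shift by 1 is multiplication by \<open>fps_exp 1\<close>, so the factor
    \<open>fps_exp 1 + 1\<close> appears and one factor \<open>euler_series\<close> turns it into
    2.\<close>
  have "euler_series ^ Suc r * fps_exp (x + 1) + euler_series ^ Suc r * fps_exp x
      = (euler_series * (fps_exp 1 + 1)) * (euler_series ^ r * fps_exp x)"
    by (simp add: fps_exp_add_mult algebra_simps)
  also have "\<dots> = fps_const 2 * (euler_series ^ r * fps_exp x)"
    by (simp add: euler_series_mult numeral_fps_const)
  finally have eq: "fps_nth (euler_series ^ Suc r * fps_exp (x + 1)) n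
      + fps_nth (euler_series ^ Suc r * fps_exp x) n
      = 2 * fps_nth (euler_series ^ r * fps_exp x) n" for n
    by (metis fps_add_nth fps_mult_left_const_nth)
  show ?thesis
    unfolding poly_umbral_op umbral_pairing_def sum.distrib[symmetric] sum_distrib_left
  proof (rule sum.cong)
    fix n
    show "coeff q n * (fact n * fps_nth (euler_series ^ Suc r * fps_exp (x + 1)) n) +
        coeff q n * (fact n * fps_nth (euler_series ^ Suc r * fps_exp x) n) =
        2 * (coeff q n * (fact n * fps_nth (euler_series ^ r * fps_exp x) n))"
      using arg_cong[OF eq, of "\<lambda>z. coeff q n * fact n * z" n]
      by (simp only: distrib_left mult_ac)
  qed simp
qed

lemma euler_poly_eq_umbral_op:
  "(euler_poly r n :: 'a::field_char_0 poly) = umbral_op (euler_series ^ r) (monom 1 n)"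
proof (rule poly_ext)
  fix x :: 'a
  have "poly (euler_poly r n) x / fact n = fps_nth (euler_series ^ r * fps_exp x) n"
    using poly_euler_poly[of r x] by (simp add: fps_eq_iff)
  then show "poly (euler_poly r n) x = poly (umbral_op (euler_series ^ r) (monom 1 n)) x"
    by (simp add: poly_umbral_op_monom field_simps)
qed

text \<open>By adjointness, \<open>1 / f\<close> cancels the \<open>f\<close> acting on the
  monomial, which leaves the coefficient of degree \<open>n\<close> in \<open>fps_X ^ k\<close>. The
  leading coefficient is the constant term of \<open>f\<close>, so the degree stays
  \<open>n\<close>.\<close>

lemma appell_umbral_op:
  fixes f :: "'a::field_char_0 fps"
  assumes "fps_nth f 0 \<noteq> 0"
  shows "appell (\<lambda>n. umbral_op f (monom 1 n)) (1 / f)"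
  unfolding appell_def sheffer_def
proof (intro conjI allI)
  have inv: "1 / f = inverse f"
    using assms by (simp add: fps_divide_unit)
  show "fps_nth (1 / f) 0 \<noteq> 0"
    using assms by (simp add: inv)
  fix n k
  show "degree (umbral_op f (monom 1 n)) = n"
    by (rule antisym[OF degree_umbral_op_monom_le le_degree])
       (use assms in \<open>simp add: coeff_umbral_op_monom\<close>)
  have "1 / f * fps_X ^ k * f = fps_X ^ k"
    using assms by (simp add: inv mult_ac inverse_mult_eq_1')
  then show "umbral_pairing (1 / f * fps_X ^ k) (umbral_op f (monom 1 n)) = (if n = k then fact n else 0)"
    by (simp only: umbral_pairing_umbral_op_monom fps_X_power_nth) simp
qed simp_all

section \<open>Continuity with respect to the absolute value\<close>

lemma absval_add_le: "absval (a + b :: 'a::valued_field) \<le> absval a + absval b"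
  using dist_triangle[of a "- b" 0] by (simp add: dist_absval)

lemma absval_nonneg: "0 \<le> absval (a :: 'a::valued_field)"
  using dist_absval[of a 0] zero_le_dist[of a 0] by simp

lemma tendsto_iff_absval:
  fixes X :: "'b \<Rightarrow> 'a::valued_field"
  shows "(X \<longlongrightarrow> l) F \<longleftrightarrow> ((\<lambda>n. absval (X n - l)) \<longlongrightarrow> 0) F"
  by (subst tendsto_dist_iff) (simp add: dist_absval)

text \<open>Induction along Horner's scheme, using only multiplicativity and the triangle
  inequality: the error splits as
  \<open>X n * (poly q (X n) - poly q l) + (X n - l) * poly q l\<close>.\<close>

lemma tendsto_poly_valued:
  fixes X :: "'b \<Rightarrow> 'a::valued_field"
  assumes X: "(X \<longlongrightarrow> l) F"
  shows "((\<lambda>n. poly q (X n)) \<longlongrightarrow> poly q l) F"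
proof (induction q)
  case (pCons a q)
  let ?d = "\<lambda>n. absval (X n - l)" and ?e = "\<lambda>n. absval (poly q (X n) - poly q l)"
  \<comment> \<open>Here \<open>?d n + absval l\<close> is a majorant of
    \<open>absval (X n)\<close>, so that only quantities with known limits occur.\<close>
  have "((\<lambda>n. (?d n + absval l) * ?e n + ?d n * absval (poly q l)) \<longlongrightarrow> (0 + absval l) * 0 + 0 * absval (poly q l)) F"
    using X pCons.IH unfolding tendsto_iff_absval by (intro tendsto_intros)
  then have lim: "((\<lambda>n. (?d n + absval l) * ?e n + ?d n * absval (poly q l)) \<longlongrightarrow> 0) F"
    by simp
  have bound: "absval (poly (pCons a q) (X n) - poly (pCons a q) l)
      \<le> (?d n + absval l) * ?e n + ?d n * absval (poly q l)" for n
  proof -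
    have "poly (pCons a q) (X n) - poly (pCons a q) l
        = X n * (poly q (X n) - poly q l) + (X n - l) * poly q l"
      by (simp add: algebra_simps)
    then have "absval (poly (pCons a q) (X n) - poly (pCons a q) l)
        \<le> absval (X n) * ?e n + ?d n * absval (poly q l)"
      by (metis absval_add_le absval_mult)
    moreover have "absval (X n) \<le> ?d n + absval l"
      using absval_add_le[of "X n - l" l] by simp
    ultimately show ?thesis
      by (smt (verit) mult_right_mono absval_nonneg)
  qed
  show ?case
    unfolding tendsto_iff_absval
    by (rule tendsto_sandwich[OF _ _ tendsto_const lim]) (use bound in \<open>auto simp: absval_nonneg\<close>)
qed simp

lemma absval_one [simp]: "absval (1 :: 'a::valued_field) = 1"
proof -
  have "absval (1 :: 'a) \<noteq> 0"
    using dist_absval[of "1::'a" 0] by (metis diff_zero dist_eq_0_iff zero_neq_one)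
  moreover have "absval (1 :: 'a) * absval (1 :: 'a) = absval (1 :: 'a)"
    using absval_mult[of "1::'a" 1] by simp
  ultimately show ?thesis by simp
qed

lemma absval_power: "absval (a ^ n :: 'a::valued_field) = absval a ^ n"
  by (induction n) (simp_all add: absval_mult)

lemma padic_abs_self:
  assumes "prime p"
  shows "padic_abs p (of_nat p) = 1 / real p"
proof -
  have "quotient_of (of_nat p) = (int p, 1)"
    using quotient_of_int[of "int p"] by (simp add: of_int_of_nat_eq)
  moreover have "multiplicity (int p) (int p) = 1"
    using assms by (intro multiplicity_self) (auto simp: prime_gt_0_nat)
  ultimately show ?thesis
    using assms by (simp add: padic_abs_def padic_val_def power_int_minus field_simps)
qed

text \<open>The absolute values are the powers of \<open>1 / real p\<close>, a geometric null
  sequence.\<close>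

lemma padic_powers_tendsto_0:
  assumes "prime p" "\<And>a. absval (of_rat a :: 'a::valued_field) = padic_abs p a"
  shows "(\<lambda>N. of_nat (p ^ N) :: 'a) \<longlonglongrightarrow> 0"
proof -
  have "absval (of_nat p :: 'a) = 1 / real p"
    using assms(2)[of "of_nat p"] padic_abs_self[OF assms(1)] by simp
  moreover have "(\<lambda>N. (1 / real p) ^ N) \<longlonglongrightarrow> 0"
    using prime_gt_1_nat[OF assms(1)] by (intro LIMSEQ_power_zero) simp
  ultimately show ?thesis
    by (simp add: tendsto_iff_absval absval_power)
qed

section \<open>Fermionic integrals of polynomials\<close>

lemma alternating_sum_telescope:
  fixes g :: "nat \<Rightarrow> 'a::comm_ring_1"
  shows "(\<Sum>y<M. (g y + g (Suc y)) * (- 1) ^ y) = g 0 - (- 1) ^ M * g M"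
  by (induction M) (simp_all add: algebra_simps)

lemma fermionic_integral_euler_op:
  fixes q :: "'a::valued_field poly"
  assumes "prime p" "odd p" "\<And>a. absval (of_rat a :: 'a) = padic_abs p a"
  shows "fermionic_integral p (\<lambda>y. poly (umbral_op (euler_series ^ r) q) (y + x))
    = poly (umbral_op (euler_series ^ Suc r) q) x"
proof -
  let ?Q = "umbral_op (euler_series ^ r) q" and ?G = "umbral_op (euler_series ^ Suc r) q"
  \<comment> \<open>Each partial sum is the value at \<open>p ^ N\<close> of one polynomial
    independent of \<open>N\<close>, with \<open>pcompose ?G [:x, 1:]\<close> standing for the
    translate of \<open>?G\<close> by \<open>x\<close>. At 0 this polynomial takes the value
    \<open>poly ?G x\<close>, the claimed limit.\<close>
  have sum: "(\<Sum>y = 0..p ^ N - 1. poly ?Q (of_nat y + x) * (- 1) ^ y)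
      = poly (smult (1 / 2) ([:poly ?G x:] + pcompose ?G [:x, 1:])) (of_nat (p ^ N))" for N
  proof -
    have "2 * poly ?Q (of_nat y + x) = poly ?G (of_nat y + x) + poly ?G (of_nat (Suc y) + x)" for y
      using euler_op_shift_add[of r q "of_nat y + x"] by (simp add: add_ac)
    then have "2 * (\<Sum>y<p ^ N. poly ?Q (of_nat y + x) * (- 1) ^ y)
        = (\<Sum>y<p ^ N. (poly ?G (of_nat y + x) + poly ?G (of_nat (Suc y) + x)) * (- 1) ^ y)"
      by (simp only: sum_distrib_left mult.assoc[symmetric])
    \<comment> \<open>As \<open>p ^ N\<close> is odd, also for \<open>N = 0\<close>, the end term
      enters with a plus sign.\<close>
    also have "\<dots> = poly ?G x + poly ?G (of_nat (p ^ N) + x)"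
      using assms(2) alternating_sum_telescope[of "\<lambda>y. poly ?G (of_nat y + x)"]
      by simp
    finally have "(\<Sum>y<p ^ N. poly ?Q (of_nat y + x) * (- 1) ^ y)
        = (poly ?G x + poly ?G (of_nat (p ^ N) + x)) / 2"
      by (simp only: eq_divide_eq_numeral1) (simp add: mult.commute)
    moreover have "{0..p ^ N - 1} = {..<p ^ N}"
      using prime_gt_0_nat[OF assms(1)] by (auto simp: Suc_le_eq[symmetric] le_diff_conv2)
    ultimately show ?thesis
      by (simp add: poly_pcompose add_ac)
  qed
  have "(\<lambda>N. \<Sum>y = 0..p ^ N - 1. poly ?Q (of_nat y + x) * (- 1) ^ y) \<longlonglongrightarrow> poly ?G x"
    unfolding sum
    using tendsto_poly_valued[OF padic_powers_tendsto_0[OF assms(1,3)],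
        of "smult (1 / 2) ([:poly ?G x:] + pcompose ?G [:x, 1:])"]
    by (simp add: poly_pcompose)
  then show ?thesis
    unfolding fermionic_integral_def by (rule limI)
qed

lemma fermionic_iterated_poly:
  fixes q :: "'a::valued_field poly"
  assumes "prime p" "odd p" "\<And>a. absval (of_rat a :: 'a) = padic_abs p a"
  shows "fermionic_iterated p r (\<lambda>xs. poly q (sum_list xs + x))
    = poly (umbral_op (euler_series ^ r) q) x"
proof (induction r arbitrary: x)
  case 0
  then show ?case by (simp add: umbral_op_1)
next
  case (Suc r)
  \<comment> \<open>The outermost variable \<open>y\<close> is absorbed into the free variable, so
    the induction hypothesis is taken at \<open>y + x\<close>; the integral over \<open>y\<close>
    then supplies the next factor \<open>euler_series\<close>.\<close>
  have "fermionic_iterated p r (\<lambda>xs. poly q (sum_list (xs @ [y]) + x))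
      = poly (umbral_op (euler_series ^ r) q) (y + x)" for y
    using Suc.IH[of "y + x"] by (simp add: add.assoc)
  then show ?case
    by (simp only: fermionic_iterated.simps fermionic_integral_euler_op[OF assms])
qed

text \<open>The moments of the iterated integral are the case of a monomial at \<open>x = 0\<close>,
  where \<open>fps_exp 0 = 1\<close>.\<close>

lemma fermionic_exp_eq_euler_series_power:
  assumes "prime p" "odd p" "\<And>a. absval (of_rat a :: 'a::valued_field) = padic_abs p a"
  shows "(fermionic_exp p r :: 'a fps) = euler_series ^ r"
proof (rule fps_ext)
  fix k
  have "fermionic_iterated p r (\<lambda>xs. sum_list xs ^ k) = fact k * fps_nth (euler_series ^ r :: 'a fps) k"
    using fermionic_iterated_poly[OF assms, of r "monom 1 k" 0]
    by (simp add: poly_monom poly_umbral_op_monom)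
  then show "fps_nth (fermionic_exp p r) k = fps_nth (euler_series ^ r :: 'a fps) k"
    by (simp add: fermionic_exp_def)
qed

theorem theorem2p3:
  fixes p r :: nat
  assumes "prime p" and "odd p"
    and "is_padic_complex p TYPE('a::valued_field)"
    and "r \<ge> 1"
  shows "(\<forall>(q::'a poly) (x::'a).
             fermionic_iterated p r (\<lambda>xs. poly q (sum_list xs + x)) =
             poly (umbral_op ((2 / (fps_exp 1 + 1)) ^ r) q) x) \<and>
         (\<forall>n. (euler_poly r n :: 'a poly) = umbral_op ((2 / (fps_exp 1 + 1)) ^ r) (monom 1 n) \<and>
              umbral_op ((2 / (fps_exp 1 + 1)) ^ r) (monom 1 n) =
              umbral_op (fermionic_exp p r) (monom (1::'a) n)) \<and>
         appell (euler_poly r :: nat \<Rightarrow> 'a poly) (1 / fermionic_exp p r)"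
proof -
  have abs: "absval (of_rat a :: 'a) = padic_abs p a" for a
    using assms(3) by (simp add: is_padic_complex_def)
  have "appell (euler_poly r :: nat \<Rightarrow> 'a poly) (1 / euler_series ^ r)"
    using appell_umbral_op[of "euler_series ^ r :: 'a fps"]
    by (simp add: euler_poly_eq_umbral_op[abs_def])
  then show ?thesis
    \<comment> \<open>Once both series are written as \<open>euler_series ^ r\<close>, all claims
      concern a single operator.\<close>
    unfolding fermionic_exp_eq_euler_series_power[OF assms(1,2) abs] euler_series_def[symmetric]
    by (simp add: fermionic_iterated_poly[OF assms(1,2) abs] euler_poly_eq_umbral_op)
qed

end
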